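(* Let $n\ge 4$ be even, let $\mathbb{D}=(\mathcal{P},\mathcal{B})$ be an $\frac{n-2}{2}$-$(n,\frac n2,1)$ design with $\mathcal{P}=\{1,\ldots,n\}$, and let $w\in \mathrm{GF}(2)^n$ be a vector whose support is a block of $\mathbb{D}$. Then $$\hat f_{\mathbb{D}}(w)=2^{n/2}-\frac{2\sum_{h=1}^{n/2}\binom{n/2}{h}\sum_{\ell=0}^{h-1}(-1)^\ell\binom{(n+2)/2}{\ell+1}}{n+2}.$$
   Context: A $t$-$(n,k,\lambda)$ design, $1\le t\le k\le n$, is a pair $(\mathcal{P},\mathcal{B})$ where $\mathcal{P}=\{1,\ldots,n\}$ and $\mathcal{B}$ is a set of $k$-subsets (blocks) of $\mathcal{P}$ such that every $t$-subset of $\mathcal{P}$ is contained in exactly $\lambda$ blocks. The support of $x\in \mathrm{GF}(2)^n$ is $\{i: x_i=1\}$. The characteristic function $f_{\mathbb{D}}:\mathrm{GF}(2)^n\to\{0,1\}\subset\mathbb{R}$ has $f_{\mathbb{D}}(x)=1$ if and only if the support of $x$ is a block. The Walsh transform is $\hat f(w)=\sum_{x\in \mathrm{GF}(2)^n}f(x)(-1)^{w\cdot x}$, where $w\cdot x=\sum_i w_ix_i$. *)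

theory Defs
  imports Complex_Main "HOL-Library.FuncSet" "HOL-Library.Z2"
begin

definition is_design :: "nat \<Rightarrow> nat \<Rightarrow> nat \<Rightarrow> nat \<Rightarrow> nat set \<Rightarrow> nat set set \<Rightarrow> bool" where
  "is_design t n k l P B \<longleftrightarrow>
     1 \<le> t \<and> t \<le> k \<and> k \<le> n \<and> P = {1..n} \<and>
     (\<forall>b\<in>B. b \<subseteq> P \<and> card b = k) \<and>
     (\<forall>T. T \<subseteq> P \<and> card T = t \<longrightarrow> card {b \<in> B. T \<subseteq> b} = l)"

(* Vectors have coordinates indexed by 1, ..., n; extensionality outside the index set makes
   each vector of GF(2)^n correspond to exactly one function. *)
definition gf2_vecs :: "nat \<Rightarrow> (nat \<Rightarrow> bit) set" where
  "gf2_vecs n = {1..n} \<rightarrow>\<^sub>E (UNIV :: bit set)"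

definition supp :: "nat \<Rightarrow> (nat \<Rightarrow> bit) \<Rightarrow> nat set" where
  "supp n x = {i \<in> {1..n}. x i = 1}"

definition dot :: "nat \<Rightarrow> (nat \<Rightarrow> bit) \<Rightarrow> (nat \<Rightarrow> bit) \<Rightarrow> bit" where
  "dot n w x = (\<Sum>i\<in>{1..n}. w i * x i)"

definition char_fun :: "nat \<Rightarrow> nat set set \<Rightarrow> (nat \<Rightarrow> bit) \<Rightarrow> real" where
  "char_fun n B x = (if supp n x \<in> B then 1 else 0)"

definition walsh :: "nat \<Rightarrow> ((nat \<Rightarrow> bit) \<Rightarrow> real) \<Rightarrow> (nat \<Rightarrow> bit) \<Rightarrow> real" where
  "walsh n f w = (\<Sum>x\<in>gf2_vecs n. f x * (- 1) ^ (of_bit (dot n w x) :: nat))"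

end

theory Submission
  imports Defs
begin

text \<open>
  Write \<open>n = 2 * m\<close>, so that the design is a Steiner system \<open>S(m - 1, m, 2 * m)\<close>, and let \<open>W\<close> be
  the block supporting \<open>w\<close>. Grouping the blocks by their intersection with \<open>W\<close>, the Walsh
  coefficient is the sum over all \<open>R \<subseteq> W\<close> of \<open>(- 1) ^ card R * N R\<close>, where \<open>N R\<close> is the number of
  blocks that meet \<open>W\<close> exactly in \<open>R\<close>. The point is that \<open>N R\<close> depends on \<open>h = m - card R\<close> only and
  has a closed form.

  To see this, fix \<open>S \<subseteq> W\<close> with \<open>m - h\<close> elements, \<open>h \<ge> 1\<close>, and let \<open>U\<close> range over the
  \<open>(h - 1)\<close>-subsets of the complement of \<open>W\<close>. Each \<open>S \<union> U\<close> has \<open>m - 1\<close> elements, so it lies in exactly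
  one block, and this block has just one further point. If that point is outside \<open>W\<close>, the block
  meets \<open>W\<close> in \<open>S\<close>, and it arises from \<open>h\<close> different sets \<open>U\<close>; if it is a point \<open>x\<close> of \<open>W\<close>, the
  block meets \<open>W\<close> in \<open>insert x S\<close> and determines \<open>U\<close>. With \<open>a h\<close> the common
  value of \<open>N R\<close> for \<open>card R = m - h\<close>, this double counting gives
  \<open>h * a h + h * a (h - 1) = (m choose (h - 1))\<close> (lemma \<open>meeting_number_recurrence\<close>) with
  \<open>a 0 = 1\<close>, and the solution is \<open>(m + 1) * a h = (m choose h) + (- 1) ^ h * m\<close>
  (lemma \<open>intersection_count\<close>).

  Taking \<open>h = m\<close>, the number of blocks disjoint from \<open>W\<close> would be negative if \<open>m\<close> were odd. So \<open>m\<close>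
  is even, the sign \<open>(- 1) ^ card R\<close> is \<open>(- 1) ^ h\<close>, and the Walsh coefficient is
  \<open>(\<Sum>h\<le>m. (m choose h) * (m + (- 1) ^ h * (m choose h))) / (m + 1)\<close>. This is
  the claimed expression, because the inner alternating sum there telescopes to
  \<open>1 - (- 1) ^ h * (m choose h)\<close>.
\<close>

section \<open>Walsh coefficients as signed sums over blocks\<close>

lemma minus_one_power_bit_sum:
  fixes u :: "'a \<Rightarrow> bit"
  assumes "finite A"
  shows "(- 1 :: real) ^ (of_bit (\<Sum>i\<in>A. u i) :: nat) = (- 1) ^ card {i \<in> A. u i = 1}"
  using assms
proof (induction A)
  case empty
  then show ?case by simp
next
  case (insert a A)
  have add: "(- 1 :: real) ^ (of_bit (x + y) :: nat) = (- 1) ^ (of_bit x :: nat) * (- 1) ^ (of_bit y :: nat)"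
    for x y :: bit
    by (cases x; cases y) auto
  have split: "{i \<in> insert a A. u i = 1} =
      (if u a = 1 then insert a {i \<in> A. u i = 1} else {i \<in> A. u i = 1})"
    by auto
  have "(- 1 :: real) ^ (of_bit (\<Sum>i\<in>insert a A. u i) :: nat) =
      (- 1) ^ (of_bit (u a) :: nat) * (- 1) ^ card {i \<in> A. u i = 1}"
    by (simp only: sum.insert[OF insert.hyps] add insert.IH)
  also have "\<dots> = (- 1) ^ card {i \<in> insert a A. u i = 1}"
    unfolding split using insert.hyps by (cases "u a") simp_all
  finally show ?case .
qed

lemma bij_betw_supp: "bij_betw (supp n) (gf2_vecs n) (Pow {1..n})"
proof (rule bij_betwI[where g = "\<lambda>X. \<lambda>i\<in>{1..n}. if i \<in> X then 1 else 0"])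
  show "supp n \<in> gf2_vecs n \<rightarrow> Pow {1..n}"
    by (auto simp: supp_def)
  show "(\<lambda>X. \<lambda>i\<in>{1..n}. if i \<in> X then 1 else 0) \<in> Pow {1..n} \<rightarrow> gf2_vecs n"
    by (auto simp: gf2_vecs_def)
  show "(\<lambda>i\<in>{1..n}. if i \<in> supp n x then 1 else 0) = x" if "x \<in> gf2_vecs n" for x
  proof
    fix i
    show "(\<lambda>i\<in>{1..n}. if i \<in> supp n x then 1 else 0) i = x i"
      using that by (cases "x i") (auto simp: gf2_vecs_def supp_def PiE_def extensional_def)
  qed
  show "supp n (\<lambda>i\<in>{1..n}. if i \<in> X then 1 else 0) = X" if "X \<in> Pow {1..n}" for X
    using that by (auto simp: supp_def)
qed

lemma walsh_char_fun:
  assumes "B \<subseteq> Pow {1..n}"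
  shows "walsh n (char_fun n B) w = (\<Sum>b\<in>B. (- 1) ^ card (b \<inter> supp n w))"
proof -
  have sign: "(- 1 :: real) ^ (of_bit (dot n w x) :: nat) = (- 1) ^ card (supp n x \<inter> supp n w)" for x
  proof -
    have "{i \<in> {1..n}. w i * x i = 1} = supp n x \<inter> supp n w"
      by (auto simp: supp_def)
    then show ?thesis
      unfolding dot_def by (subst minus_one_power_bit_sum) auto
  qed
  have "walsh n (char_fun n B) w =
      (\<Sum>x\<in>gf2_vecs n. (if supp n x \<in> B then 1 else 0) * (- 1) ^ card (supp n x \<inter> supp n w))"
    by (simp only: walsh_def char_fun_def sign)
  also have "\<dots> = (\<Sum>b\<in>Pow {1..n}. (if b \<in> B then 1 else 0) * (- 1) ^ card (b \<inter> supp n w))"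
    by (rule sum.reindex_bij_betw[OF bij_betw_supp])
  also have "\<dots> = (\<Sum>b\<in>B. (- 1) ^ card (b \<inter> supp n w))"
    using assms by (intro sum.mono_neutral_cong_right) auto
  finally show ?thesis .
qed

section \<open>Intersection numbers of a Steiner system with respect to a block\<close>

locale steiner_system_with_block =
  fixes V :: "'a set" and B :: "'a set set" and m :: nat and W :: "'a set"
  assumes finite_V: "finite V" and card_V: "card V = 2 * m" and m_pos: "m \<ge> 1"
    and block_subset: "b \<in> B \<Longrightarrow> b \<subseteq> V"
    and block_card: "b \<in> B \<Longrightarrow> card b = m"
    and unique_block: "T \<subseteq> V \<Longrightarrow> card T = m - 1 \<Longrightarrow> card {b \<in> B. T \<subseteq> b} = 1"
    and W_block: "W \<in> B"
begin

definition meeting_number :: "'a set \<Rightarrow> nat" where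
  "meeting_number R = card {b \<in> B. b \<inter> W = R}"

lemma finite_B: "finite B"
  using finite_V block_subset by (meson finite_Pow_iff finite_subset PowI subsetI)

lemma finite_block: "b \<in> B \<Longrightarrow> finite b"
  using finite_V block_subset finite_subset by blast

lemma W_subset: "W \<subseteq> V" and card_W: "card W = m" and finite_W: "finite W"
  using W_block block_subset block_card finite_block by auto

lemma sum_over_blocks:
  fixes g :: "'a set \<Rightarrow> real"
  shows "(\<Sum>b\<in>B. g (b \<inter> W)) = (\<Sum>R\<in>Pow W. real (meeting_number R) * g R)"
proof -
  have "(\<Sum>b\<in>B. g (b \<inter> W)) = (\<Sum>R\<in>Pow W. \<Sum>b\<in>{b \<in> B. b \<inter> W = R}. g (b \<inter> W))"
    by (rule sum.group[symmetric]) (use finite_B finite_W in auto)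
  also have "\<dots> = (\<Sum>R\<in>Pow W. real (meeting_number R) * g R)"
    by (intro sum.cong refl) (simp add: meeting_number_def)
  finally show ?thesis .
qed

lemma meeting_number_W: "meeting_number W = 1"
proof -
  have "b = W" if "b \<in> B" "b \<inter> W = W" for b
  proof -
    have "W \<subseteq> b"
      using that by blast
    then show ?thesis
      using card_subset_eq[of b W] finite_block block_card card_W that by metis
  qed
  then have "{b \<in> B. b \<inter> W = W} = {W}"
    using W_block by auto
  then show ?thesis
    by (simp add: meeting_number_def)
qed

text \<open>
  Both sides count the pairs of an \<open>h\<close>-subset \<open>U\<close> of the complement of \<open>W\<close> and a block containing
  \<open>S \<union> U\<close>: on the right through the unique block of each of the \<open>(m - 1)\<close>-sets \<open>S \<union> U\<close>, on the left
  through the trace \<open>R\<close> of the block on \<open>W\<close>. A block with trace \<open>R\<close> has \<open>m - card R\<close> points outside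
  \<open>W\<close> from which \<open>U\<close> is chosen.
\<close>

lemma double_count:
  assumes S: "S \<subseteq> W" and card_S: "card S + Suc h = m"
  shows "(\<Sum>R\<in>Pow W. real (meeting_number R) * (if S \<subseteq> R then real ((m - card R) choose h) else 0)) =
    real (m choose h)"
proof -
  define \<U> where "\<U> = {U. U \<subseteq> V - W \<and> card U = h}"
  have fin: "finite (V - W)" and fin_U: "finite \<U>"
    using finite_V by (auto simp: \<U>_def)
  have card_VW: "card (V - W) = m"
    using card_Diff_subset[OF finite_W W_subset] card_V card_W by simp
  have choices: "(\<Sum>U\<in>\<U>. if S \<union> U \<subseteq> b then 1 else 0 :: real) =
      (if S \<subseteq> b \<inter> W then real ((m - card (b \<inter> W)) choose h) else 0)" if b: "b \<in> B" for b
  proof -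
    have "card (b - W) = m - card (b \<inter> W)"
      using card_Diff_subset_Int[of b W] finite_block[OF b] block_card[OF b] by simp
    moreover have "{U \<in> \<U>. U \<subseteq> b} = {U. U \<subseteq> b - W \<and> card U = h}"
      using block_subset[OF b] by (auto simp: \<U>_def)
    ultimately have "card {U \<in> \<U>. U \<subseteq> b} = (m - card (b \<inter> W)) choose h"
      using n_subsets[of "b - W" h] finite_block[OF b] by simp
    moreover have "(\<Sum>U\<in>\<U>. if S \<union> U \<subseteq> b then 1 else 0 :: real) =
        (if S \<subseteq> b then real (card {U \<in> \<U>. U \<subseteq> b}) else 0)"
      using fin_U by (simp add: sum.If_cases Int_def)
    ultimately show ?thesis
      using S by auto
  qed
  have unique: "(\<Sum>b\<in>B. if S \<union> U \<subseteq> b then 1 else 0 :: real) = 1" if U: "U \<in> \<U>" for U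
  proof -
    have "finite U" "finite S" "S \<inter> U = {}"
      using U S finite_W finite_subset[OF _ fin] finite_subset by (auto simp: \<U>_def)
    then have "card (S \<union> U) = m - 1"
      using U card_S by (simp add: card_Un_disjoint \<U>_def)
    moreover have "S \<union> U \<subseteq> V"
      using U S W_subset by (auto simp: \<U>_def)
    ultimately have "card {b \<in> B. S \<union> U \<subseteq> b} = 1"
      using unique_block by blast
    moreover have "(\<Sum>b\<in>B. if S \<union> U \<subseteq> b then 1 else 0 :: real) = real (card {b \<in> B. S \<union> U \<subseteq> b})"
      using finite_B by (simp add: sum.If_cases Int_def)
    ultimately show ?thesis
      by simp
  qed
  have "(\<Sum>R\<in>Pow W. real (meeting_number R) * (if S \<subseteq> R then real ((m - card R) choose h) else 0)) =
      (\<Sum>b\<in>B. if S \<subseteq> b \<inter> W then real ((m - card (b \<inter> W)) choose h) else 0)"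
    by (rule sum_over_blocks[symmetric])
  also have "\<dots> = (\<Sum>b\<in>B. \<Sum>U\<in>\<U>. if S \<union> U \<subseteq> b then 1 else 0)"
    using choices by (intro sum.cong) auto
  also have "\<dots> = (\<Sum>U\<in>\<U>. \<Sum>b\<in>B. if S \<union> U \<subseteq> b then 1 else 0)"
    by (rule sum.swap)
  also have "\<dots> = real (card \<U>)"
    using unique by simp
  also have "\<dots> = real (m choose h)"
    using n_subsets[OF fin, of h] card_VW by (simp add: \<U>_def)
  finally show ?thesis .
qed

text \<open>
  In the double count only the traces \<open>S\<close> and \<open>insert x S\<close> survive, since a block with a larger
  trace has fewer than \<open>h\<close> points outside \<open>W\<close>.
\<close>

lemma meeting_number_recurrence:
  assumes S: "S \<subseteq> W" and card_S: "card S + Suc h = m"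
  shows "real (Suc h) * real (meeting_number S) + (\<Sum>x\<in>W - S. real (meeting_number (insert x S))) =
    real (m choose h)"
proof -
  define g where
    "g R = real (meeting_number R) * (if S \<subseteq> R then real ((m - card R) choose h) else 0)" for R
  have fin_S: "finite S"
    using S finite_W finite_subset by blast
  let ?I = "(\<lambda>x. insert x S) ` (W - S)"
  have vanish: "g R = 0" if R: "R \<in> Pow W - insert S ?I" for R
  proof (cases "S \<subseteq> R")
    case True
    have fin_R: "finite R"
      using R finite_W finite_subset by blast
    obtain x where x: "x \<in> R" "x \<notin> S"
      using R True by auto
    then have "insert x S \<noteq> R"
      using R by auto
    then have "insert x S \<subset> R"
      using x True by auto
    then have "card (insert x S) < card R"
      using fin_R by (rule psubset_card_mono[rotated])
    then have "card S + 2 \<le> card R"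
      using x fin_S by simp
    moreover have "card R \<le> m"
      using R card_W card_mono[OF finite_W, of R] by auto
    ultimately have "m - card R < h"
      using card_S by linarith
    then show ?thesis
      by (simp add: g_def binomial_eq_0)
  qed (simp add: g_def)
  have "real (m choose h) = sum g (Pow W)"
    using double_count[OF S card_S] by (simp add: g_def)
  also have "\<dots> = sum g (insert S ?I)"
    by (rule sum.mono_neutral_right) (use vanish finite_W S in auto)
  also have "\<dots> = g S + sum g ?I"
    using finite_W by (subst sum.insert) auto
  also have "sum g ?I = (\<Sum>x\<in>W - S. g (insert x S))"
    by (subst sum.reindex) (auto simp: inj_on_def)
  also have "\<dots> = (\<Sum>x\<in>W - S. real (meeting_number (insert x S)))"
  proof (rule sum.cong)
    fix x assume "x \<in> W - S"
    then have "m - card (insert x S) = h"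
      using fin_S card_S by simp
    then show "g (insert x S) = real (meeting_number (insert x S))"
      by (simp add: g_def subset_insertI)
  qed simp
  also have "g S = real (Suc h) * real (meeting_number S)"
  proof -
    have "m - card S = Suc h"
      using card_S by simp
    then show ?thesis
      by (simp add: g_def)
  qed
  finally show ?thesis by simp
qed

text \<open>
  The closed form solves the recurrence because of Pascal's rule and the absorption identity
  \<open>Suc h * (Suc m choose Suc h) = Suc m * (m choose h)\<close>.
\<close>

lemma intersection_count:
  assumes "S \<subseteq> W" and "card S + h = m"
  shows "real (Suc m) * real (meeting_number S) = real (m choose h) + (- 1) ^ h * real m"
  using assms
proof (induction h arbitrary: S)
  case 0
  then have "S = W"
    using card_subset_eq[OF finite_W] card_W by simp
  then show ?case
    by (simp add: meeting_number_W)
next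
  case (Suc h)
  have fin_S: "finite S"
    using Suc.prems finite_W finite_subset by blast
  let ?c = "real (m choose h) + (- 1) ^ h * real m"
  have IH: "real (Suc m) * real (meeting_number (insert x S)) = ?c" if "x \<in> W - S" for x
    using that Suc.prems fin_S by (intro Suc.IH) auto
  have card_rest: "card (W - S) = Suc h"
    using Suc.prems card_Diff_subset[OF fin_S] card_W by simp
  have "real (Suc m) * (\<Sum>x\<in>W - S. real (meeting_number (insert x S))) = real (Suc h) * ?c"
    unfolding sum_distrib_left using IH card_rest by simp
  then have "real (Suc h) * (real (Suc m) * real (meeting_number S)) + real (Suc h) * ?c =
      real (Suc m) * (real (Suc h) * real (meeting_number S) +
        (\<Sum>x\<in>W - S. real (meeting_number (insert x S))))"
    by (simp only: distrib_left mult.left_commute)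
  also have "\<dots> = real (Suc m) * real (m choose h)"
    using meeting_number_recurrence[OF Suc.prems(1,2)] by simp
  also have "\<dots> = real (Suc h) * real (Suc m choose Suc h)"
    using Suc_times_binomial_eq[of m h] by (metis mult.commute of_nat_mult)
  finally have "real (Suc h) * (real (Suc m) * real (meeting_number S) + ?c) =
      real (Suc h) * real (Suc m choose Suc h)"
    by (simp only: distrib_left)
  then have "real (Suc m) * real (meeting_number S) + ?c = real (Suc m choose Suc h)"
    by (simp only: mult_cancel_left of_nat_eq_0_iff) simp
  then show ?case
    by simp
qed

text \<open>
  Otherwise the closed form gives \<open>1 - m\<close> for \<open>m + 1\<close> times the number of blocks disjoint from \<open>W\<close>,
  which is negative.
\<close>

lemma even_block_size:
  assumes "m \<ge> 2"
  shows "even m"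
proof (rule ccontr)
  assume "odd m"
  then have "real (Suc m) * real (meeting_number {}) = 1 - real m"
    using intersection_count[of "{}" m] by simp
  moreover have "0 \<le> real (Suc m) * real (meeting_number {})"
    by simp
  ultimately show False
    using assms by linarith
qed

lemma signed_block_sum:
  assumes "m \<ge> 2"
  shows "(\<Sum>b\<in>B. (- 1 :: real) ^ card (b \<inter> W)) =
    (\<Sum>h\<le>m. real (m choose h) * (real m + (- 1) ^ h * real (m choose h))) / real (Suc m)"
proof -
  define c where "c j = real m + (- 1) ^ j * real (m choose j)" for j
  have summand: "real (meeting_number R) * (- 1) ^ card R = c (card R) / real (Suc m)"
    if R: "R \<in> Pow W" for R
  proof -
    have le: "card R \<le> m"
      using R card_W finite_W card_mono[of W R] by auto
    have count: "real (Suc m) * real (meeting_number R) =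
        real (m choose card R) + (- 1) ^ card R * real m"
    proof -
      have "(- 1 :: real) ^ (m - card R) = (- 1) ^ card R"
        using le even_block_size[OF assms] by (simp add: minus_one_power_iff)
      then show ?thesis
        using intersection_count[of R "m - card R"] R le binomial_symmetric[OF le] by simp
    qed
    have "real (Suc m) * (real (meeting_number R) * (- 1) ^ card R) =
        (real (m choose card R) + (- 1) ^ card R * real m) * (- 1) ^ card R"
      unfolding count[symmetric] by (simp only: mult.assoc)
    also have "\<dots> = c (card R)"
      by (cases "even (card R)") (simp_all add: c_def)
    finally show ?thesis
      by (simp add: field_simps del: of_nat_Suc)
  qed
  have "(\<Sum>b\<in>B. (- 1 :: real) ^ card (b \<inter> W)) = (\<Sum>R\<in>Pow W. c (card R) / real (Suc m))"
    using sum_over_blocks[of "\<lambda>R. (- 1) ^ card R"] summand by simp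
  also have "\<dots> = (\<Sum>h\<le>m. \<Sum>R\<in>{R \<in> Pow W. card R = h}. c (card R) / real (Suc m))"
    by (rule sum.group[symmetric]) (use finite_W card_W card_mono in auto)
  also have "\<dots> = (\<Sum>h\<le>m. real (m choose h) * c h / real (Suc m))"
  proof (rule sum.cong)
    fix h
    have "card {R \<in> Pow W. card R = h} = m choose h"
      using n_subsets[OF finite_W, of h] card_W by (simp add: Pow_def)
    then show "(\<Sum>R\<in>{R \<in> Pow W. card R = h}. c (card R) / real (Suc m)) =
        real (m choose h) * c h / real (Suc m)"
      by simp
  qed simp
  finally show ?thesis
    by (simp add: c_def sum_divide_distrib)
qed

end

section \<open>The alternating binomial sum\<close>

lemma alternating_binomial_partial_sum:
  "(\<Sum>l<h. (- 1) ^ l * real (Suc m choose Suc l)) = 1 - (- 1) ^ h * real (m choose h)"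
  by (induction h) (simp_all add: algebra_simps)

lemma binomial_alternating_sum_expansion:
  "2 ^ m - 2 * (\<Sum>h=1..m. real (m choose h) * (\<Sum>l=0..h - 1. (- 1) ^ l * real (Suc m choose Suc l)))
      / real (2 * Suc m) =
    (\<Sum>h\<le>m. real (m choose h) * (real m + (- 1) ^ h * real (m choose h))) / real (Suc m)"
proof -
  define e where "e h = 1 - (- 1) ^ h * real (m choose h)" for h
  have inner: "(\<Sum>l=0..h - 1. (- 1) ^ l * real (Suc m choose Suc l)) = e h" if "h \<in> {1..m}" for h
  proof -
    have "{0..h - 1} = {..<h}"
      using that by auto
    then show ?thesis
      by (simp only: alternating_binomial_partial_sum e_def)
  qed
  have pow2: "(\<Sum>h\<le>m. real (m choose h)) = 2 ^ m"
    using choose_row_sum[of m] by (metis of_nat_numeral of_nat_power of_nat_sum)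
  have "(\<Sum>h=1..m. real (m choose h) * (\<Sum>l=0..h - 1. (- 1) ^ l * real (Suc m choose Suc l))) =
      (\<Sum>h=1..m. real (m choose h) * e h)"
    using inner by (intro sum.cong) auto
  also have "\<dots> = (\<Sum>h\<le>m. real (m choose h) * e h)"
    \<comment> \<open>The summand for \<open>h = 0\<close> vanishes.\<close>
    by (rule sum.mono_neutral_left) (auto simp: e_def not_less_eq_eq)
  also have "\<dots> = (\<Sum>h\<le>m. real (Suc m) * real (m choose h) -
      real (m choose h) * (real m + (- 1) ^ h * real (m choose h)))"
    by (intro sum.cong) (simp_all add: e_def algebra_simps)
  also have "\<dots> = real (Suc m) * 2 ^ m -
      (\<Sum>h\<le>m. real (m choose h) * (real m + (- 1) ^ h * real (m choose h)))"
    by (simp only: sum_subtractf sum_distrib_left[symmetric] pow2)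
  finally have outer:
    "(\<Sum>h=1..m. real (m choose h) * (\<Sum>l=0..h - 1. (- 1) ^ l * real (Suc m choose Suc l))) =
      real (Suc m) * 2 ^ m -
      (\<Sum>h\<le>m. real (m choose h) * (real m + (- 1) ^ h * real (m choose h)))" .
  have ratio: "p - 2 * (a * p - s) / (2 * a) = s / a" if "a \<noteq> 0" for a p s :: real
    using that by (simp add: field_simps)
  show ?thesis
    unfolding outer of_nat_mult of_nat_numeral by (rule ratio) simp
qed

section \<open>The Walsh coefficient at a block\<close>

theorem theorem31:
  fixes n :: nat and P :: "nat set" and B :: "nat set set" and w :: "nat \<Rightarrow> bit"
  assumes "n \<ge> 4" and "even n"
    and "is_design ((n - 2) div 2) n (n div 2) 1 P B"
    and "w \<in> gf2_vecs n" and "supp n w \<in> B"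
  shows "walsh n (char_fun n B) w =
    2 ^ (n div 2) -
      2 * (\<Sum>h=1..n div 2. real ((n div 2) choose h) *
            (\<Sum>l=0..h - 1. (- 1) ^ l * real (((n + 2) div 2) choose (l + 1))))
      / real (n + 2)"
proof -
  obtain m where n: "n = 2 * m"
    using assms(2) by blast
  have m: "m \<ge> 2"
    using assms(1) n by simp
  have halves: "n div 2 = m" "(n - 2) div 2 = m - 1" "(n + 2) div 2 = Suc m" "n + 2 = 2 * Suc m"
    using n by simp_all
  have design: "P = {1..n}" "\<And>b. b \<in> B \<Longrightarrow> b \<subseteq> P" "\<And>b. b \<in> B \<Longrightarrow> card b = m"
    "\<And>T. T \<subseteq> P \<Longrightarrow> card T = m - 1 \<Longrightarrow> card {b \<in> B. T \<subseteq> b} = 1"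
    using assms(3) unfolding is_design_def halves by blast+
  interpret steiner_system_with_block P B m "supp n w"
    using design m n assms(5) by unfold_locales auto
  have "walsh n (char_fun n B) w = (\<Sum>b\<in>B. (- 1) ^ card (b \<inter> supp n w))"
    using design by (intro walsh_char_fun) auto
  then show ?thesis
    unfolding signed_block_sum[OF m] binomial_alternating_sum_expansion[symmetric]
    unfolding halves(1,3) by (simp only: halves(4) Suc_eq_plus1[symmetric])
qed

end
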